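(* Let $d\in\{2,3\}$, let $\Omega\subset\mathbb{R}^d$ be an open, bounded, convex polytope, let $s\in(\tfrac d4,1)$, and let $\theta\in(\tfrac d2-s,\,s)$. Let $\mathcal{D}\subset\Omega$ be a finite set with $\ell=\#\mathcal{D}$ elements, let $u_\Omega\in L^2(\Omega)$, $\alpha>0$, and let $\mathbf a=\{a_z\}_{z\in\mathcal{D}}$, $\mathbf b=\{b_z\}_{z\in\mathcal{D}}\in\mathbb{R}^\ell$ satisfy $a_z<b_z$ for every $z\in\mathcal{D}$. Set $\mathbf{Q}_{ad}=\{\mathbf q\in\mathbb{R}^\ell:\ a_z\le q_z\le b_z\ \ \forall z\in\mathcal{D}\}$. Let $\mathbf{S}:\mathbb{R}^\ell\to\mathbb{H}^{s-\theta}(\Omega)$ map $\mathbf q$ to the unique $u=\mathbf{S}\mathbf q\in\mathbb{H}^{s-\theta}(\Omega)$ such that $\mathcal{A}(u,v)=\sum_{z\in\mathcal{D}}q_zv(z)$ for all $v\in\mathbb{H}^{s+\theta}(\Omega)$, and let $$j(\mathbf q)=\tfrac12\|\mathbf{S}\mathbf q-u_\Omega\|_{L^2(\Omega)}^2+\tfrac\alpha2\|\mathbf q\|_{\mathbb{R}^\ell}^2 .$$ Let $\bar{\mathbf q}\in\mathbf{Q}_{ad}$, let $\bar u=\mathbf{S}\bar{\mathbf q}$, and let $\bar p\in\mathbb{H}^s(\Omega)$ be the unique solution of the adjoint problem $$\mathcal{B}(\bar p,w)=(\bar u-u_\Omega,w)_{L^2(\Omega)}\qquad\forall w\in\mathbb{H}^s(\Omega).$$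 Then $\bar{\mathbf q}$ is optimal, i.e. $j(\bar{\mathbf q})=\min_{\mathbf q\in\mathbf{Q}_{ad}}j(\mathbf q)$, if and only if $$\sum_{z\in\mathcal{D}}\big(\bar p(z)+\alpha\bar q_z\big)\big(q_z-\bar q_z\big)\ge0\qquad\forall\,\mathbf q=\{q_z\}_{z\in\mathcal{D}}\in\mathbf{Q}_{ad}.$$
   Context: Let $\{(\lambda_k,\varphi_k)\}_{k\in\mathbb{N}}$ be the eigenpairs of the Dirichlet Laplacian on $\Omega$, i.e. $\varphi_k\in H^1_0(\Omega)\setminus\{0\}$ and $(\nabla\varphi_k,\nabla v)_{L^2(\Omega)}=\lambda_k(\varphi_k,v)_{L^2(\Omega)}$ for all $v\in H_0^1(\Omega)$, with $\lambda_k>0$, $\lambda_k\to\infty$, and $\{\varphi_k\}$ an orthonormal basis of $L^2(\Omega)$. For $w\in L^2(\Omega)$ write $w_k=\int_\Omega w\varphi_k\,dx$. For $r\ge0$, $$\mathbb{H}^r(\Omega)=\Big\{w\in L^2(\Omega):\ \sum_{k}\lambda_k^r|w_k|^2<\infty\Big\},\qquad \|w\|_{\mathbb{H}^r(\Omega)}=\Big(\sum_k\lambda_k^r|w_k|^2\Big)^{1/2}.$$ The bilinear forms $\mathcal{A}:\mathbb{H}^{s-\theta}(\Omega)\times\mathbb{H}^{s+\theta}(\Omega)\to\mathbb{R}$ and $\mathcal{B}:\mathbb{H}^{s}(\Omega)\times\mathbb{H}^{s}(\Omega)\to\mathbb{R}$ are both given by the formula $(v,w)\mapsto\sum_{k=1}^\infty\lambda_k^s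 v_kw_k$. For $r\in(\tfrac d2,2)$ one has the continuous embedding of $\mathbb{H}^{r}(\Omega)$ into $C_0(\Omega)$, the continuous functions on $\bar\Omega$ vanishing on $\partial\Omega$, and elements of $\mathbb{H}^r(\Omega)$ are identified with their continuous representatives. This applies with $r=s+\theta$, so $v(z)$ is well defined in the state equation, which is uniquely solvable in $\mathbb{H}^{s-\theta}(\Omega)\subset L^2(\Omega)$ for each $\mathbf q\in\mathbb{R}^\ell$. It also applies with $r=2s$: since $\bar u-u_\Omega\in L^2(\Omega)$, the solution of the adjoint problem satisfies $\bar p\in\mathbb{H}^{2s}(\Omega)$, so $\bar p(z)$ is well defined. $\|\cdot\|_{\mathbb{R}^\ell}$ is the Euclidean norm. *)

theory Defs
  imports "HOL-Analysis.Analysis"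
begin

section \<open>Square-integrable functions\<close>

text \<open>Elements of $L^2(\Omega)$ are represented by functions on the whole space; only their
  values almost everywhere on the domain matter.\<close>

definition L2 :: "(real^'n) set \<Rightarrow> (real^'n \<Rightarrow> real) set" where
  "L2 \<Omega> = {f. f \<in> borel_measurable (lebesgue_on \<Omega>) \<and> integrable (lebesgue_on \<Omega>) (\<lambda>x. (f x)\<^sup>2)}"

definition L2_inner :: "(real^'n) set \<Rightarrow> (real^'n \<Rightarrow> real) \<Rightarrow> (real^'n \<Rightarrow> real) \<Rightarrow> real" where
  "L2_inner \<Omega> f g = (LINT x|lebesgue_on \<Omega>. f x * g x)"

definition L2_norm :: "(real^'n) set \<Rightarrow> (real^'n \<Rightarrow> real) \<Rightarrow> real" where
  "L2_norm \<Omega> f = sqrt (LINT x|lebesgue_on \<Omega>. (f x)\<^sup>2)"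


section \<open>The Sobolev space with zero boundary values\<close>

definition partial_deriv :: "'n \<Rightarrow> (real^'n \<Rightarrow> real) \<Rightarrow> real^'n \<Rightarrow> real" where
  "partial_deriv i f x = frechet_derivative f (at x) (axis i 1)"

primrec Ck :: "nat \<Rightarrow> (real^'n \<Rightarrow> real) \<Rightarrow> bool" where
  "Ck 0 f \<longleftrightarrow> continuous_on UNIV f"
| "Ck (Suc k) f \<longleftrightarrow> (\<forall>x. f differentiable (at x)) \<and> (\<forall>i. Ck k (partial_deriv i f))"

definition test_functions :: "(real^'n) set \<Rightarrow> (real^'n \<Rightarrow> real) set" where
  "test_functions \<Omega> = {\<psi>. (\<forall>k. Ck k \<psi>) \<and>
     compact (closure {x. \<psi> x \<noteq> 0}) \<and> closure {x. \<psi> x \<noteq> 0} \<subseteq> \<Omega>}"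

definition has_weak_gradient ::
    "(real^'n) set \<Rightarrow> (real^'n \<Rightarrow> real) \<Rightarrow> (real^'n \<Rightarrow> real^'n) \<Rightarrow> bool" where
  "has_weak_gradient \<Omega> f g \<longleftrightarrow>
     (\<forall>i. (\<lambda>x. g x $ i) \<in> L2 \<Omega> \<and>
       (\<forall>\<psi>\<in>test_functions \<Omega>.
          L2_inner \<Omega> f (partial_deriv i \<psi>) = - L2_inner \<Omega> (\<lambda>x. g x $ i) \<psi>))"

text \<open>Weak gradients are unique almost everywhere, so the choice is harmless under integrals.\<close>

definition weak_gradient :: "(real^'n) set \<Rightarrow> (real^'n \<Rightarrow> real) \<Rightarrow> real^'n \<Rightarrow> real^'n" where
  "weak_gradient \<Omega> f = (SOME g. has_weak_gradient \<Omega> f g)"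

definition H1 :: "(real^'n) set \<Rightarrow> (real^'n \<Rightarrow> real) set" where
  "H1 \<Omega> = {f \<in> L2 \<Omega>. \<exists>g. has_weak_gradient \<Omega> f g}"

text \<open>The closure of the test functions in the norm of $H^1(\Omega)$.\<close>

definition H10 :: "(real^'n) set \<Rightarrow> (real^'n \<Rightarrow> real) set" where
  "H10 \<Omega> = {f \<in> H1 \<Omega>. \<exists>\<psi>::nat \<Rightarrow> real^'n \<Rightarrow> real.
     (\<forall>n. \<psi> n \<in> test_functions \<Omega>) \<and>
     (\<lambda>n. L2_norm \<Omega> (\<lambda>x. \<psi> n x - f x)) \<longlonglongrightarrow> 0 \<and>
     (\<forall>i. (\<lambda>n. L2_norm \<Omega> (\<lambda>x. partial_deriv i (\<psi> n) x - weak_gradient \<Omega> f x $ i)) \<longlonglongrightarrow> 0)}"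


section \<open>Dirichlet eigenpairs and spectral spaces\<close>

definition L2_orthonormal_basis :: "(real^'n) set \<Rightarrow> (nat \<Rightarrow> real^'n \<Rightarrow> real) \<Rightarrow> bool" where
  "L2_orthonormal_basis \<Omega> \<phi> \<longleftrightarrow>
     (\<forall>k. \<phi> k \<in> L2 \<Omega>) \<and>
     (\<forall>j k. L2_inner \<Omega> (\<phi> j) (\<phi> k) = (if j = k then 1 else 0)) \<and>
     (\<forall>f\<in>L2 \<Omega>. (\<lambda>n. L2_norm \<Omega> (\<lambda>x. f x - (\<Sum>k<n. L2_inner \<Omega> f (\<phi> k) * \<phi> k x))) \<longlonglongrightarrow> 0)"

definition dirichlet_eigenpairs ::
    "(real^'n) set \<Rightarrow> (nat \<Rightarrow> real) \<Rightarrow> (nat \<Rightarrow> real^'n \<Rightarrow> real) \<Rightarrow> bool" where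
  "dirichlet_eigenpairs \<Omega> \<mu> \<phi> \<longleftrightarrow>
     (\<forall>k. \<phi> k \<in> H10 \<Omega> \<and> \<not> (AE x in lebesgue_on \<Omega>. \<phi> k x = 0) \<and>
        (\<forall>v\<in>H10 \<Omega>. (LINT x|lebesgue_on \<Omega>. weak_gradient \<Omega> (\<phi> k) x \<bullet> weak_gradient \<Omega> v x)
            = \<mu> k * L2_inner \<Omega> (\<phi> k) v)) \<and>
     (\<forall>k. \<mu> k > 0) \<and> filterlim \<mu> at_top sequentially \<and>
     L2_orthonormal_basis \<Omega> \<phi>"

definition spectral_space ::
    "(real^'n) set \<Rightarrow> (nat \<Rightarrow> real) \<Rightarrow> (nat \<Rightarrow> real^'n \<Rightarrow> real) \<Rightarrow> real \<Rightarrow> (real^'n \<Rightarrow> real) set" where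
  "spectral_space \<Omega> \<mu> \<phi> r =
     {w \<in> L2 \<Omega>. summable (\<lambda>k. \<mu> k powr r * (L2_inner \<Omega> w (\<phi> k))\<^sup>2)}"

text \<open>Both bilinear forms $\mathcal{A}$ and $\mathcal{B}$ are given by this formula; they differ only
  in the spaces the arguments are taken from, on which the series converges absolutely.\<close>

definition spectral_form ::
    "(real^'n) set \<Rightarrow> (nat \<Rightarrow> real) \<Rightarrow> (nat \<Rightarrow> real^'n \<Rightarrow> real) \<Rightarrow> real
      \<Rightarrow> (real^'n \<Rightarrow> real) \<Rightarrow> (real^'n \<Rightarrow> real) \<Rightarrow> real" where
  "spectral_form \<Omega> \<mu> \<phi> s v w =
     (\<Sum>k. \<mu> k powr s * L2_inner \<Omega> v (\<phi> k) * L2_inner \<Omega> w (\<phi> k))"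

text \<open>The representative in $C_0(\Omega)$; its values on the closure of the domain are unique
  when it exists, and it exists for all elements of the spectral space of order $r$ with $d/2<r<2$
  on a convex polytope.\<close>

definition cont_rep :: "(real^'n) set \<Rightarrow> (real^'n \<Rightarrow> real) \<Rightarrow> real^'n \<Rightarrow> real" where
  "cont_rep \<Omega> w = (SOME g. continuous_on (closure \<Omega>) g \<and> (\<forall>x\<in>frontier \<Omega>. g x = 0) \<and>
     (AE x in lebesgue_on \<Omega>. g x = w x))"


section \<open>The optimal control problem\<close>

definition open_convex_polytope :: "(real^'n) set \<Rightarrow> bool" where
  "open_convex_polytope \<Omega> \<longleftrightarrow>
     open \<Omega> \<and> \<Omega> \<noteq> {} \<and> bounded \<Omega> \<and> convex \<Omega> \<and> polytope (closure \<Omega>)"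

text \<open>Vectors in $\mathbb{R}^\ell$ indexed by the points of $\mathcal{D}$ are the extensional
  functions in \<open>\<D> \<rightarrow>\<^sub>E UNIV\<close>.\<close>

definition admissible :: "(real^'n) set \<Rightarrow> (real^'n \<Rightarrow> real) \<Rightarrow> (real^'n \<Rightarrow> real) \<Rightarrow> (real^'n \<Rightarrow> real) set" where
  "admissible \<D> a b = {q \<in> \<D> \<rightarrow>\<^sub>E UNIV. \<forall>z\<in>\<D>. a z \<le> q z \<and> q z \<le> b z}"

definition is_state ::
    "(real^'n) set \<Rightarrow> (nat \<Rightarrow> real) \<Rightarrow> (nat \<Rightarrow> real^'n \<Rightarrow> real) \<Rightarrow> real \<Rightarrow> real \<Rightarrow> (real^'n) set
      \<Rightarrow> (real^'n \<Rightarrow> real) \<Rightarrow> (real^'n \<Rightarrow> real) \<Rightarrow> bool" where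
  "is_state \<Omega> \<mu> \<phi> s \<theta> \<D> q u \<longleftrightarrow>
     u \<in> spectral_space \<Omega> \<mu> \<phi> (s - \<theta>) \<and>
     (\<forall>v\<in>spectral_space \<Omega> \<mu> \<phi> (s + \<theta>).
        spectral_form \<Omega> \<mu> \<phi> s u v = (\<Sum>z\<in>\<D>. q z * cont_rep \<Omega> v z))"

definition is_adjoint_state ::
    "(real^'n) set \<Rightarrow> (nat \<Rightarrow> real) \<Rightarrow> (nat \<Rightarrow> real^'n \<Rightarrow> real) \<Rightarrow> real
      \<Rightarrow> (real^'n \<Rightarrow> real) \<Rightarrow> (real^'n \<Rightarrow> real) \<Rightarrow> (real^'n \<Rightarrow> real) \<Rightarrow> bool" where
  "is_adjoint_state \<Omega> \<mu> \<phi> s u\<^sub>\<Omega> u p \<longleftrightarrow>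
     p \<in> spectral_space \<Omega> \<mu> \<phi> s \<and>
     (\<forall>w\<in>spectral_space \<Omega> \<mu> \<phi> s.
        spectral_form \<Omega> \<mu> \<phi> s p w = L2_inner \<Omega> (\<lambda>x. u x - u\<^sub>\<Omega> x) w)"

definition cost ::
    "(real^'n) set \<Rightarrow> (real^'n) set \<Rightarrow> (real^'n \<Rightarrow> real) \<Rightarrow> real
      \<Rightarrow> ((real^'n \<Rightarrow> real) \<Rightarrow> real^'n \<Rightarrow> real) \<Rightarrow> (real^'n \<Rightarrow> real) \<Rightarrow> real" where
  "cost \<Omega> \<D> u\<^sub>\<Omega> \<alpha> S q =
     1/2 * (L2_norm \<Omega> (\<lambda>x. S q x - u\<^sub>\<Omega> x))\<^sup>2 + \<alpha>/2 * (L2_set q \<D>)\<^sup>2"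

end

theory Submission
  imports Defs
begin

text \<open>Testing the state equation with the eigenfunctions shows that the Fourier coefficients of
  \<open>S q\<close> depend linearly on \<open>q\<close>, and testing the adjoint equation with them gives
  \<open>\<mu>\<^sub>k\<^sup>s p\<^sub>k = (u - u\<^sub>\<Omega>)\<^sub>k\<close> for \<open>u = S q\<^sub>0\<close>. Hence \<open>p\<close> has the additional regularity needed to be a test
  function in the state equation, which by Parseval turns \<open>(u - u\<^sub>\<Omega>, S q - u)\<close> into
  \<open>\<Sum>z. p(z) (q z - q\<^sub>0 z)\<close>. The cost along a segment starting at \<open>q\<^sub>0\<close> is therefore a quadratic
  polynomial with nonnegative leading coefficient whose linear coefficient is the expression in
  the variational inequality.\<close>

section \<open>The inner product on square-integrable functions\<close>

text \<open>The sum of the two squares dominates the product. The additivity laws for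
  \<open>L2_inner\<close> below rest on this integrability.\<close>

lemma L2_integrable_mult:
  assumes "f \<in> L2 \<Omega>" "g \<in> L2 \<Omega>"
  shows "integrable (lebesgue_on \<Omega>) (\<lambda>x. f x * g x)"
proof (rule Bochner_Integration.integrable_bound)
  show "integrable (lebesgue_on \<Omega>) (\<lambda>x. (f x)\<^sup>2 + (g x)\<^sup>2)"
    using assms by (auto simp: L2_def)
  show "(\<lambda>x. f x * g x) \<in> borel_measurable (lebesgue_on \<Omega>)"
    using assms by (auto simp: L2_def)
  have "\<bar>y * z\<bar> \<le> y\<^sup>2 + z\<^sup>2" for y z :: real
    using sum_squares_bound[of "\<bar>y\<bar>" "\<bar>z\<bar>"] abs_ge_zero[of "y * z"]
    by (simp only: power2_abs abs_mult)
  then show "AE x in lebesgue_on \<Omega>. norm (f x * g x) \<le> norm ((f x)\<^sup>2 + (g x)\<^sup>2)"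
    by simp
qed

lemma L2_add:
  assumes "f \<in> L2 \<Omega>" "g \<in> L2 \<Omega>"
  shows "(\<lambda>x. f x + g x) \<in> L2 \<Omega>"
proof -
  have "integrable (lebesgue_on \<Omega>) (\<lambda>x. (f x)\<^sup>2 + (g x)\<^sup>2 + 2 * (f x * g x))"
    using assms L2_integrable_mult[OF assms] by (auto simp: L2_def)
  then show ?thesis
    using assms by (auto simp: L2_def power2_sum mult.assoc)
qed

lemma L2_scale: "f \<in> L2 \<Omega> \<Longrightarrow> (\<lambda>x. c * f x) \<in> L2 \<Omega>"
  by (auto simp: L2_def power_mult_distrib)

lemma L2_diff:
  assumes "f \<in> L2 \<Omega>" "g \<in> L2 \<Omega>"
  shows "(\<lambda>x. f x - g x) \<in> L2 \<Omega>"
  using L2_add[OF assms(1) L2_scale[OF assms(2), of "-1"]] by simp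

lemma L2_sum: "(\<And>k. k \<in> A \<Longrightarrow> f k \<in> L2 \<Omega>) \<Longrightarrow> (\<lambda>x. \<Sum>k\<in>A. f k x) \<in> L2 \<Omega>"
proof (induction A rule: infinite_finite_induct)
  case (insert k A)
  then show ?case
    by (simp add: L2_add)
qed (auto simp: L2_def)

lemma L2_inner_commute: "L2_inner \<Omega> f g = L2_inner \<Omega> g f"
  by (simp add: L2_inner_def mult.commute)

lemma L2_inner_add_left:
  assumes "f \<in> L2 \<Omega>" "g \<in> L2 \<Omega>" "h \<in> L2 \<Omega>"
  shows "L2_inner \<Omega> (\<lambda>x. f x + g x) h = L2_inner \<Omega> f h + L2_inner \<Omega> g h"
  using assms by (simp add: L2_inner_def distrib_right L2_integrable_mult)

lemma L2_inner_diff_left: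
  assumes "f \<in> L2 \<Omega>" "g \<in> L2 \<Omega>" "h \<in> L2 \<Omega>"
  shows "L2_inner \<Omega> (\<lambda>x. f x - g x) h = L2_inner \<Omega> f h - L2_inner \<Omega> g h"
  using assms by (simp add: L2_inner_def left_diff_distrib L2_integrable_mult)

lemma L2_inner_scale_left: "L2_inner \<Omega> (\<lambda>x. c * f x) g = c * L2_inner \<Omega> f g"
  by (simp add: L2_inner_def mult.assoc)

lemma L2_inner_sum_left:
  assumes "\<And>k. k \<in> A \<Longrightarrow> f k \<in> L2 \<Omega>" "g \<in> L2 \<Omega>"
  shows "L2_inner \<Omega> (\<lambda>x. \<Sum>k\<in>A. f k x) g = (\<Sum>k\<in>A. L2_inner \<Omega> (f k) g)"
  using assms by (simp add: L2_inner_def sum_distrib_right L2_integrable_mult)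

lemma L2_inner_self_nonneg: "0 \<le> L2_inner \<Omega> f f"
  by (simp add: L2_inner_def)

lemma L2_norm_eq_sqrt_inner: "L2_norm \<Omega> f = sqrt (L2_inner \<Omega> f f)"
  by (simp add: L2_norm_def L2_inner_def power2_eq_square)

lemma L2_norm_power2: "(L2_norm \<Omega> f)\<^sup>2 = L2_inner \<Omega> f f"
  by (simp add: L2_norm_eq_sqrt_inner L2_inner_self_nonneg)

lemma L2_norm_add_power2:
  assumes "f \<in> L2 \<Omega>" "g \<in> L2 \<Omega>"
  shows "(L2_norm \<Omega> (\<lambda>x. f x + g x))\<^sup>2
    = (L2_norm \<Omega> f)\<^sup>2 + 2 * L2_inner \<Omega> f g + (L2_norm \<Omega> g)\<^sup>2"
proof -
  have "L2_inner \<Omega> h (\<lambda>x. f x + g x) = L2_inner \<Omega> f h + L2_inner \<Omega> g h" if "h \<in> L2 \<Omega>" for h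
    using L2_inner_add_left[OF assms that] L2_inner_commute by metis
  then show ?thesis
    using assms by (simp add: L2_norm_power2 L2_inner_add_left L2_add L2_inner_commute[of \<Omega> g f])
qed

text \<open>The squared norm of \<open>f + t * g\<close> is a quadratic polynomial in
  \<open>t\<close> that is nonnegative for every real \<open>t\<close>; suitable choices of
  \<open>t\<close> give the bound.\<close>

lemma L2_Cauchy_Schwarz:
  assumes f: "f \<in> L2 \<Omega>" and g: "g \<in> L2 \<Omega>"
  shows "\<bar>L2_inner \<Omega> f g\<bar> \<le> L2_norm \<Omega> f * L2_norm \<Omega> g"
proof -
  let ?A = "L2_inner \<Omega> f f" and ?B = "L2_inner \<Omega> f g" and ?C = "L2_inner \<Omega> g g"
  have quad: "0 \<le> ?A + 2 * t * ?B + t\<^sup>2 * ?C" for t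
  proof -
    have "L2_inner \<Omega> h (\<lambda>x. t * g x) = t * L2_inner \<Omega> h g" for h
      using L2_inner_scale_left L2_inner_commute by metis
    then have "(L2_norm \<Omega> (\<lambda>x. f x + t * g x))\<^sup>2 = ?A + 2 * t * ?B + t\<^sup>2 * ?C"
      unfolding L2_norm_add_power2[OF f L2_scale[OF g]]
      unfolding L2_norm_power2 by (simp add: L2_inner_scale_left power2_eq_square)
    then show ?thesis
      by (metis zero_le_power2)
  qed
  have "?B\<^sup>2 \<le> ?A * ?C"
  proof (cases "?C = 0")
    case True
    have "?B = 0"
    proof (rule ccontr)
      assume "?B \<noteq> 0"
      \<comment> \<open>For \<open>?C = 0\<close> the polynomial is affine; this \<open>t\<close>
        makes its value \<open>-1\<close>.\<close>
      then show False
        using quad[of "- (?A + 1) / (2 * ?B)"] True by (simp add: field_simps)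
    qed
    then show ?thesis
      using True by simp
  next
    case False
    then have "?C > 0"
      using L2_inner_self_nonneg[of \<Omega> g] by simp
    \<comment> \<open>The minimiser \<open>t = - ?B / ?C\<close> leaves
      \<open>?A - ?B\<^sup>2 / ?C\<close>.\<close>
    then show ?thesis
      using quad[of "- ?B / ?C"] by (simp add: field_simps power2_eq_square)
  qed
  then have "sqrt (?B\<^sup>2) \<le> sqrt (?A * ?C)"
    by (rule real_sqrt_le_mono)
  then show ?thesis
    by (simp add: L2_norm_eq_sqrt_inner real_sqrt_mult)
qed

section \<open>Fourier expansions\<close>

text \<open>The partial Fourier sums \<open>P n\<close> of \<open>f\<close> converge to
  \<open>f\<close> in norm, so by Cauchy-Schwarz their inner products with the fixed
  \<open>g\<close> converge too. These inner products are exactly the partial sums of the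
  series.\<close>

lemma L2_Parseval:
  assumes basis: "L2_orthonormal_basis \<Omega> \<phi>" and f: "f \<in> L2 \<Omega>" and g: "g \<in> L2 \<Omega>"
  shows "(\<lambda>k. L2_inner \<Omega> f (\<phi> k) * L2_inner \<Omega> g (\<phi> k)) sums L2_inner \<Omega> f g"
proof -
  define P where "P n x = (\<Sum>k<n. L2_inner \<Omega> f (\<phi> k) * \<phi> k x)" for n x
  have \<phi>: "\<phi> k \<in> L2 \<Omega>" for k
    using basis by (simp add: L2_orthonormal_basis_def)
  have P: "P n \<in> L2 \<Omega>" for n
    unfolding P_def[abs_def] by (intro L2_sum L2_scale \<phi>)
  have inner_P: "L2_inner \<Omega> (P n) g = (\<Sum>k<n. L2_inner \<Omega> f (\<phi> k) * L2_inner \<Omega> g (\<phi> k))" for n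
    unfolding P_def[abs_def]
    by (subst L2_inner_sum_left) (auto intro: L2_scale \<phi> g
        simp: L2_inner_scale_left L2_inner_commute[of \<Omega> g])
  have bound: "\<bar>L2_inner \<Omega> (P n) g - L2_inner \<Omega> f g\<bar>
      \<le> L2_norm \<Omega> (\<lambda>x. f x - P n x) * L2_norm \<Omega> g" for n
    using L2_Cauchy_Schwarz[OF L2_diff[OF f P] g] by (simp add: L2_inner_diff_left f g P abs_minus_commute)
  have "(\<lambda>n. L2_norm \<Omega> (\<lambda>x. f x - P n x)) \<longlonglongrightarrow> 0"
    using basis f by (simp add: L2_orthonormal_basis_def P_def)
  then have "(\<lambda>n. L2_norm \<Omega> (\<lambda>x. f x - P n x) * L2_norm \<Omega> g) \<longlonglongrightarrow> 0"
    by (rule tendsto_mult_left_zero)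
  then have "(\<lambda>n. L2_inner \<Omega> (P n) g - L2_inner \<Omega> f g) \<longlonglongrightarrow> 0"
    by (rule Lim_null_comparison[rotated]) (simp add: bound)
  then have "(\<lambda>n. L2_inner \<Omega> (P n) g) \<longlonglongrightarrow> L2_inner \<Omega> f g"
    by (rule LIM_zero_cancel)
  then show ?thesis
    by (simp add: sums_def inner_P)
qed

text \<open>By Parseval a norm depends on the Fourier coefficients alone. Scaling can thus be used
  without a pointwise identity between \<open>f\<close> and a multiple of \<open>g\<close>.\<close>

lemma L2_norm_scaled_coefficients:
  assumes basis: "L2_orthonormal_basis \<Omega> \<phi>" and f: "f \<in> L2 \<Omega>" and g: "g \<in> L2 \<Omega>"
    and eq: "\<And>k. L2_inner \<Omega> f (\<phi> k) = t * L2_inner \<Omega> g (\<phi> k)"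
  shows "(L2_norm \<Omega> f)\<^sup>2 = t\<^sup>2 * (L2_norm \<Omega> g)\<^sup>2"
proof -
  have "(\<lambda>k. L2_inner \<Omega> f (\<phi> k) * L2_inner \<Omega> f (\<phi> k)) sums (t\<^sup>2 * L2_inner \<Omega> g g)"
    using sums_mult[OF L2_Parseval[OF basis g g], of "t\<^sup>2"]
    by (simp add: eq power2_eq_square mult_ac)
  then show ?thesis
    using L2_Parseval[OF basis f f] sums_unique2 by (force simp: L2_norm_power2)
qed

text \<open>Only the term \<open>k = j\<close> of the series is nonzero, so the eigenfunctions are
  legitimate test functions in both the state and the adjoint equation.\<close>

lemma basis_in_spectral_space:
  assumes "L2_orthonormal_basis \<Omega> \<phi>"
  shows "\<phi> j \<in> spectral_space \<Omega> \<mu> \<phi> r"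
proof -
  have "summable (\<lambda>k. \<mu> k powr r * (L2_inner \<Omega> (\<phi> j) (\<phi> k))\<^sup>2)"
    by (rule summable_finite[of "{j}"]) (use assms in \<open>auto simp: L2_orthonormal_basis_def\<close>)
  then show ?thesis
    using assms by (simp add: spectral_space_def L2_orthonormal_basis_def)
qed

lemma spectral_form_basis:
  assumes "L2_orthonormal_basis \<Omega> \<phi>"
  shows "spectral_form \<Omega> \<mu> \<phi> s v (\<phi> j) = \<mu> j powr s * L2_inner \<Omega> v (\<phi> j)"
  unfolding spectral_form_def
  by (subst suminf_finite[of "{j}"]) (use assms in \<open>auto simp: L2_orthonormal_basis_def\<close>)

section \<open>State and adjoint state\<close>

lemma is_state_coefficient:
  assumes "L2_orthonormal_basis \<Omega> \<phi>" "is_state \<Omega> \<mu> \<phi> s \<theta> \<D> q u"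
  shows "\<mu> k powr s * L2_inner \<Omega> u (\<phi> k) = (\<Sum>z\<in>\<D>. q z * cont_rep \<Omega> (\<phi> k) z)"
  using assms basis_in_spectral_space[OF assms(1)] spectral_form_basis[OF assms(1)]
  unfolding is_state_def by metis

lemma is_adjoint_state_coefficient:
  assumes "L2_orthonormal_basis \<Omega> \<phi>" "is_adjoint_state \<Omega> \<mu> \<phi> s u\<^sub>\<Omega> u p"
  shows "\<mu> k powr s * L2_inner \<Omega> p (\<phi> k) = L2_inner \<Omega> (\<lambda>x. u x - u\<^sub>\<Omega> x) (\<phi> k)"
  using assms basis_in_spectral_space[OF assms(1)] spectral_form_basis[OF assms(1)]
  unfolding is_adjoint_state_def by metis

text \<open>The weight \<open>\<mu> k powr (2 * s)\<close> turns the squared coefficients of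
  \<open>p\<close> into those of the residual, which are summable by Parseval; a smaller exponent
  \<open>r\<close> is handled by comparison.\<close>

lemma is_adjoint_state_regularity:
  assumes "dirichlet_eigenpairs \<Omega> \<mu> \<phi>" and adj: "is_adjoint_state \<Omega> \<mu> \<phi> s u\<^sub>\<Omega> u p"
    and f: "(\<lambda>x. u x - u\<^sub>\<Omega> x) \<in> L2 \<Omega>" and "r \<le> 2 * s"
  shows "p \<in> spectral_space \<Omega> \<mu> \<phi> r"
proof -
  let ?f = "\<lambda>k. L2_inner \<Omega> (\<lambda>x. u x - u\<^sub>\<Omega> x) (\<phi> k)"
  have basis: "L2_orthonormal_basis \<Omega> \<phi>" and \<mu>: "filterlim \<mu> at_top sequentially"
    using assms(1) by (auto simp: dirichlet_eigenpairs_def)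
  have "summable (\<lambda>k. (?f k)\<^sup>2)"
    using L2_Parseval[OF basis f f] by (auto simp: power2_eq_square sums_iff)
  moreover have "\<forall>\<^sub>F k in sequentially.
      norm (\<mu> k powr r * (L2_inner \<Omega> p (\<phi> k))\<^sup>2) \<le> (?f k)\<^sup>2"
    \<comment> \<open>Powers increase with the exponent only for bases at least 1. All but finitely
      many eigenvalues exceed 1, which suffices for summability.\<close>
    using filterlim_at_top_dense[THEN iffD1, OF \<mu>, rule_format, of 1]
  proof eventually_elim
    case (elim k)
    have "\<mu> k powr r * (L2_inner \<Omega> p (\<phi> k))\<^sup>2 \<le> \<mu> k powr (2 * s) * (L2_inner \<Omega> p (\<phi> k))\<^sup>2"
      using elim \<open>r \<le> 2 * s\<close> by (intro mult_right_mono powr_mono) auto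
    also have "\<dots> = (\<mu> k powr s * L2_inner \<Omega> p (\<phi> k))\<^sup>2"
      unfolding mult_2 powr_add power2_eq_square by (simp only: mult_ac)
    also have "\<dots> = (?f k)\<^sup>2"
      by (simp add: is_adjoint_state_coefficient[OF basis adj])
    finally show ?case
      by simp
  qed
  ultimately have "summable (\<lambda>k. \<mu> k powr r * (L2_inner \<Omega> p (\<phi> k))\<^sup>2)"
    by (rule summable_comparison_test_ev[rotated])
  then show ?thesis
    using adj by (simp add: is_adjoint_state_def spectral_space_def)
qed

text \<open>Parseval and the adjoint coefficients
  \<open>\<mu> k powr s * L2_inner \<Omega> p (\<phi> k)\<close> rewrite the left side as the form
  of \<open>v\<close> and \<open>p\<close>. Testing the state equation of \<open>v\<close> with
  \<open>p\<close> then produces the point values.\<close>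

lemma L2_inner_adjoint_residual:
  assumes eig: "dirichlet_eigenpairs \<Omega> \<mu> \<phi>" and adj: "is_adjoint_state \<Omega> \<mu> \<phi> s u\<^sub>\<Omega> u p"
    and f: "(\<lambda>x. u x - u\<^sub>\<Omega> x) \<in> L2 \<Omega>" and "\<theta> \<le> s" and v: "is_state \<Omega> \<mu> \<phi> s \<theta> \<D> q v"
  shows "L2_inner \<Omega> (\<lambda>x. u x - u\<^sub>\<Omega> x) v = (\<Sum>z\<in>\<D>. q z * cont_rep \<Omega> p z)"
proof -
  have basis: "L2_orthonormal_basis \<Omega> \<phi>"
    using eig by (simp add: dirichlet_eigenpairs_def)
  have "v \<in> L2 \<Omega>"
    using v by (simp add: is_state_def spectral_space_def)
  then have "(\<lambda>k. L2_inner \<Omega> v (\<phi> k) * L2_inner \<Omega> (\<lambda>x. u x - u\<^sub>\<Omega> x) (\<phi> k)) sums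
      L2_inner \<Omega> (\<lambda>x. u x - u\<^sub>\<Omega> x) v"
    using L2_Parseval[OF basis _ f] L2_inner_commute by metis
  then have "L2_inner \<Omega> (\<lambda>x. u x - u\<^sub>\<Omega> x) v = spectral_form \<Omega> \<mu> \<phi> s v p"
    by (simp add: spectral_form_def sums_iff mult_ac
        flip: is_adjoint_state_coefficient[OF basis adj])
  also have "\<dots> = (\<Sum>z\<in>\<D>. q z * cont_rep \<Omega> p z)"
    \<comment> \<open>The order of the test space satisfies \<open>s + \<theta> \<le> 2 * s\<close>,
      so \<open>p\<close> belongs to it.\<close>
    using v is_adjoint_state_regularity[OF eig adj f, of "s + \<theta>"] \<open>\<theta> \<le> s\<close>
    by (simp add: is_state_def)
  finally show ?thesis .
qed

section \<open>Exact expansion of the cost\<close>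

text \<open>Both squares are expanded around \<open>q\<^sub>0\<close>. The cross term of the
  tracking part becomes a sum of point values of \<open>p\<close>, which joins the cross term of the
  control part to form the linear term; the last bracket is the quadratic remainder.\<close>

lemma cost_expansion:
  assumes eig: "dirichlet_eigenpairs \<Omega> \<mu> \<phi>" and "\<theta> \<le> s" and u\<^sub>\<Omega>: "u\<^sub>\<Omega> \<in> L2 \<Omega>"
    and q: "is_state \<Omega> \<mu> \<phi> s \<theta> \<D> q (S q)" and q\<^sub>0: "is_state \<Omega> \<mu> \<phi> s \<theta> \<D> q\<^sub>0 (S q\<^sub>0)"
    and adj: "is_adjoint_state \<Omega> \<mu> \<phi> s u\<^sub>\<Omega> (S q\<^sub>0) p"
  shows "cost \<Omega> \<D> u\<^sub>\<Omega> \<alpha> S q = cost \<Omega> \<D> u\<^sub>\<Omega> \<alpha> S q\<^sub>0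
    + (\<Sum>z\<in>\<D>. (cont_rep \<Omega> p z + \<alpha> * q\<^sub>0 z) * (q z - q\<^sub>0 z))
    + (1/2 * (L2_norm \<Omega> (\<lambda>x. S q x - S q\<^sub>0 x))\<^sup>2 + \<alpha>/2 * (\<Sum>z\<in>\<D>. (q z - q\<^sub>0 z)\<^sup>2))"
proof -
  let ?f = "\<lambda>x. S q\<^sub>0 x - u\<^sub>\<Omega> x" and ?e = "\<lambda>x. S q x - S q\<^sub>0 x"
  have L2: "S q \<in> L2 \<Omega>" "S q\<^sub>0 \<in> L2 \<Omega>"
    using q q\<^sub>0 by (auto simp: is_state_def spectral_space_def)
  have f: "?f \<in> L2 \<Omega>" and e: "?e \<in> L2 \<Omega>"
    using L2 u\<^sub>\<Omega> by (auto intro: L2_diff)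
  have "(L2_norm \<Omega> (\<lambda>x. S q x - u\<^sub>\<Omega> x))\<^sup>2
      = (L2_norm \<Omega> ?f)\<^sup>2 + 2 * L2_inner \<Omega> ?f ?e + (L2_norm \<Omega> ?e)\<^sup>2"
    using L2_norm_add_power2[OF f e] by simp
  \<comment> \<open>The residual identity is applied to the states of \<open>q\<close> and of
    \<open>q\<^sub>0\<close>, and the two results are subtracted.\<close>
  moreover have "L2_inner \<Omega> ?f ?e = (\<Sum>z\<in>\<D>. (q z - q\<^sub>0 z) * cont_rep \<Omega> p z)"
    using L2_inner_adjoint_residual[OF eig adj f \<open>\<theta> \<le> s\<close> q]
      L2_inner_adjoint_residual[OF eig adj f \<open>\<theta> \<le> s\<close> q\<^sub>0]
    by (simp add: L2_inner_commute[of \<Omega> ?f] L2_inner_diff_left[OF L2 f] left_diff_distrib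
        sum_subtractf)
  moreover have "(L2_set q \<D>)\<^sup>2 = (L2_set q\<^sub>0 \<D>)\<^sup>2 + 2 * (\<Sum>z\<in>\<D>. q\<^sub>0 z * (q z - q\<^sub>0 z))
      + (\<Sum>z\<in>\<D>. (q z - q\<^sub>0 z)\<^sup>2)"
    by (simp add: L2_set_def sum_nonneg sum_distrib_left flip: sum.distrib)
      (intro sum.cong refl, simp add: power2_eq_square algebra_simps)
  moreover have "(\<Sum>z\<in>\<D>. (cont_rep \<Omega> p z + \<alpha> * q\<^sub>0 z) * (q z - q\<^sub>0 z))
      = (\<Sum>z\<in>\<D>. (q z - q\<^sub>0 z) * cont_rep \<Omega> p z) + \<alpha> * (\<Sum>z\<in>\<D>. q\<^sub>0 z * (q z - q\<^sub>0 z))"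
    unfolding sum_distrib_left sum.distrib[symmetric]
    by (intro sum.cong refl) (simp add: algebra_simps)
  moreover have "1/2 * (F + 2 * I + E) + \<alpha>/2 * (X + 2 * Y + Z)
      = 1/2 * F + \<alpha>/2 * X + (I + \<alpha> * Y) + (1/2 * E + \<alpha>/2 * Z)" for F I E X Y Z :: real
    by (simp add: field_simps)
  ultimately show ?thesis
    by (simp only: cost_def)
qed

text \<open>Linearity of the control-to-state map is available through coefficients: those of a
  state, weighted by \<open>\<mu> k powr s\<close>, are linear in the control. Cancelling the
  positive weight gives coefficients scaled by \<open>t\<close>, hence squared norms scaled by
  \<open>t\<^sup>2\<close>.\<close>

lemma state_norm_segment:
  assumes eig: "dirichlet_eigenpairs \<Omega> \<mu> \<phi>"
    and u: "is_state \<Omega> \<mu> \<phi> s \<theta> \<D> q u" and u\<^sub>0: "is_state \<Omega> \<mu> \<phi> s \<theta> \<D> q\<^sub>0 u\<^sub>0"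
    and u': "is_state \<Omega> \<mu> \<phi> s \<theta> \<D> q' u'"
    and q': "\<And>z. z \<in> \<D> \<Longrightarrow> q' z = q\<^sub>0 z + t * (q z - q\<^sub>0 z)"
  shows "(L2_norm \<Omega> (\<lambda>x. u' x - u\<^sub>0 x))\<^sup>2 = t\<^sup>2 * (L2_norm \<Omega> (\<lambda>x. u x - u\<^sub>0 x))\<^sup>2"
proof -
  have basis: "L2_orthonormal_basis \<Omega> \<phi>" and \<mu>: "\<mu> k > 0" for k
    using eig by (auto simp: dirichlet_eigenpairs_def)
  have \<phi>: "\<phi> k \<in> L2 \<Omega>" for k
    using basis by (simp add: L2_orthonormal_basis_def)
  have L2: "u \<in> L2 \<Omega>" "u\<^sub>0 \<in> L2 \<Omega>" "u' \<in> L2 \<Omega>"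
    using u u\<^sub>0 u' by (auto simp: is_state_def spectral_space_def)
  have "L2_inner \<Omega> (\<lambda>x. u' x - u\<^sub>0 x) (\<phi> k) = t * L2_inner \<Omega> (\<lambda>x. u x - u\<^sub>0 x) (\<phi> k)" for k
  proof -
    have "(\<Sum>z\<in>\<D>. q' z * cont_rep \<Omega> (\<phi> k) z) = (\<Sum>z\<in>\<D>. q\<^sub>0 z * cont_rep \<Omega> (\<phi> k) z)
        + t * ((\<Sum>z\<in>\<D>. q z * cont_rep \<Omega> (\<phi> k) z) - (\<Sum>z\<in>\<D>. q\<^sub>0 z * cont_rep \<Omega> (\<phi> k) z))"
      unfolding sum_subtractf[symmetric] sum_distrib_left sum.distrib[symmetric]
      by (intro sum.cong refl) (simp add: q' algebra_simps)
    then have "\<mu> k powr s * (L2_inner \<Omega> u' (\<phi> k) - L2_inner \<Omega> u\<^sub>0 (\<phi> k))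
        = \<mu> k powr s * (t * (L2_inner \<Omega> u (\<phi> k) - L2_inner \<Omega> u\<^sub>0 (\<phi> k)))"
      unfolding is_state_coefficient[OF basis u, symmetric]
        is_state_coefficient[OF basis u\<^sub>0, symmetric] is_state_coefficient[OF basis u', symmetric]
      by (simp add: algebra_simps)
    moreover have "\<mu> k powr s \<noteq> 0"
      using \<mu>[of k] by simp
    ultimately show ?thesis
      by (simp add: L2_inner_diff_left L2 \<phi>)
  qed
  then show ?thesis
    using L2 by (intro L2_norm_scaled_coefficients[OF basis] L2_diff)
qed

section \<open>First-order optimality\<close>

text \<open>Division by \<open>t > 0\<close> leaves \<open>0 \<le> L + t * M\<close>, and
  \<open>t\<close> tends to 0 along \<open>1 / (n + 1)\<close>, which stays in the permitted
  range.\<close>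

lemma nonneg_linear_coefficient:
  fixes L M :: real
  assumes "\<And>t. 0 < t \<Longrightarrow> t \<le> 1 \<Longrightarrow> 0 \<le> t * L + t\<^sup>2 * M"
  shows "0 \<le> L"
proof (rule LIMSEQ_le_const)
  show "(\<lambda>n. L + inverse (real (Suc n)) * M) \<longlonglongrightarrow> L"
    using tendsto_add[OF tendsto_const tendsto_mult_left_zero[OF LIMSEQ_inverse_real_of_nat]]
    by simp
  have "0 \<le> L + t * M" if "0 < t" "t \<le> 1" for t
  proof -
    have "0 \<le> t * (L + t * M)"
      using assms[OF that] by (simp add: power2_eq_square algebra_simps)
    then show ?thesis
      using that by (simp add: zero_le_mult_iff)
  qed
  then show "\<exists>N. \<forall>n\<ge>N. 0 \<le> L + inverse (real (Suc n)) * M"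
    by (simp add: inverse_le_1_iff)
qed

theorem theorem3:
  fixes \<Omega> \<D> :: "(real^'n) set"
    and \<mu> :: "nat \<Rightarrow> real" and \<phi> :: "nat \<Rightarrow> real^'n \<Rightarrow> real"
    and s \<theta> \<alpha> :: real
    and u\<^sub>\<Omega> p :: "real^'n \<Rightarrow> real"
    and a b q\<^sub>0 :: "real^'n \<Rightarrow> real"
    and S :: "(real^'n \<Rightarrow> real) \<Rightarrow> real^'n \<Rightarrow> real"
  assumes "CARD('n) \<in> {2, 3}"
    and "open_convex_polytope \<Omega>"
    and "dirichlet_eigenpairs \<Omega> \<mu> \<phi>"
    and "s \<in> {real CARD('n) / 4 <..< 1}"
    and "\<theta> \<in> {real CARD('n) / 2 - s <..< s}"
    and "finite \<D>" and "\<D> \<subseteq> \<Omega>"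
    and "u\<^sub>\<Omega> \<in> L2 \<Omega>"
    and "\<alpha> > 0"
    and "\<And>z. z \<in> \<D> \<Longrightarrow> a z < b z"
    and "\<And>q. q \<in> \<D> \<rightarrow>\<^sub>E UNIV \<Longrightarrow> is_state \<Omega> \<mu> \<phi> s \<theta> \<D> q (S q)"
    and "q\<^sub>0 \<in> admissible \<D> a b"
    and "is_adjoint_state \<Omega> \<mu> \<phi> s u\<^sub>\<Omega> (S q\<^sub>0) p"
  shows "(\<forall>q\<in>admissible \<D> a b. cost \<Omega> \<D> u\<^sub>\<Omega> \<alpha> S q\<^sub>0 \<le> cost \<Omega> \<D> u\<^sub>\<Omega> \<alpha> S q) \<longleftrightarrow>
    (\<forall>q\<in>admissible \<D> a b. (\<Sum>z\<in>\<D>. (cont_rep \<Omega> p z + \<alpha> * q\<^sub>0 z) * (q z - q\<^sub>0 z)) \<ge> 0)"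
proof
  let ?c = "cost \<Omega> \<D> u\<^sub>\<Omega> \<alpha> S"
  let ?L = "\<lambda>q. \<Sum>z\<in>\<D>. (cont_rep \<Omega> p z + \<alpha> * q\<^sub>0 z) * (q z - q\<^sub>0 z)"
  let ?M = "\<lambda>q. 1/2 * (L2_norm \<Omega> (\<lambda>x. S q x - S q\<^sub>0 x))\<^sup>2 + \<alpha>/2 * (\<Sum>z\<in>\<D>. (q z - q\<^sub>0 z)\<^sup>2)"
  note state = assms(11)
  have ext: "q \<in> \<D> \<rightarrow>\<^sub>E UNIV" if "q \<in> admissible \<D> a b" for q
    using that by (simp add: admissible_def)
  have "\<theta> \<le> s"
    using assms(5) by simp
  have expansion: "?c q = ?c q\<^sub>0 + ?L q + ?M q" if "q \<in> \<D> \<rightarrow>\<^sub>E UNIV" for q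
    by (rule cost_expansion[OF assms(3) \<open>\<theta> \<le> s\<close> assms(8) state[OF that]
          state[OF ext[OF assms(12)]] assms(13)])
  {
    \<comment> \<open>Sufficiency: in the expansion both the linear term and the remainder are
      nonnegative.\<close>
    assume var: "\<forall>q\<in>admissible \<D> a b. ?L q \<ge> 0"
    have "?M q \<ge> 0" for q
      using \<open>\<alpha> > 0\<close> by (simp add: sum_nonneg)
    then show "\<forall>q\<in>admissible \<D> a b. ?c q\<^sub>0 \<le> ?c q"
      using var expansion[OF ext] by (smt (verit))
  }
  assume opt: "\<forall>q\<in>admissible \<D> a b. ?c q\<^sub>0 \<le> ?c q"
  show "\<forall>q\<in>admissible \<D> a b. ?L q \<ge> 0"
  proof
    fix q assume q: "q \<in> admissible \<D> a b"
    show "?L q \<ge> 0"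
    proof (rule nonneg_linear_coefficient)
      fix t :: real assume t: "0 < t" "t \<le> 1"
      \<comment> \<open>Necessity: optimality is tested on the segment from \<open>q\<^sub>0\<close>
        to \<open>q\<close>. The restriction to \<open>\<D>\<close> keeps the point extensional, as
        \<open>admissible\<close> demands.\<close>
      define q' where "q' = (\<lambda>z\<in>\<D>. q\<^sub>0 z + t * (q z - q\<^sub>0 z))"
      have q'_in: "q' z = q\<^sub>0 z + t * (q z - q\<^sub>0 z)" if "z \<in> \<D>" for z
        using that by (simp add: q'_def)
      \<comment> \<open>Each component is a convex combination of two points of the interval from
        \<open>a z\<close> to \<open>b z\<close>.\<close>
      have "a z \<le> q' z \<and> q' z \<le> b z" if z: "z \<in> \<D>" for z
      proof -
        have "q' z = (1 - t) * q\<^sub>0 z + t * q z"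
          by (simp add: q'_in[OF z] algebra_simps)
        moreover have "q\<^sub>0 z \<in> {a z..b z}" "q z \<in> {a z..b z}"
          using q assms(12) z by (auto simp: admissible_def)
        ultimately show ?thesis
          using convexD[of "{a z..b z}" "q\<^sub>0 z" "q z" "1 - t" t] t by simp
      qed
      then have q': "q' \<in> admissible \<D> a b"
        by (simp add: admissible_def q'_def)
      have "?L q' = t * ?L q"
        unfolding sum_distrib_left by (intro sum.cong refl) (simp add: q'_in)
      moreover have "(\<Sum>z\<in>\<D>. (q' z - q\<^sub>0 z)\<^sup>2) = t\<^sup>2 * (\<Sum>z\<in>\<D>. (q z - q\<^sub>0 z)\<^sup>2)"
        unfolding sum_distrib_left by (intro sum.cong refl) (simp add: q'_in power_mult_distrib)
      then have "?M q' = t\<^sup>2 * ?M q"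
        using state_norm_segment[OF assms(3) state[OF ext[OF q]] state[OF ext[OF assms(12)]]
            state[OF ext[OF q']] q'_in]
        by (simp add: algebra_simps)
      \<comment> \<open>By the expansion at \<open>q'\<close>, this expression is the cost
        difference between \<open>q'\<close> and the optimal \<open>q\<^sub>0\<close>.\<close>
      ultimately show "0 \<le> t * ?L q + t\<^sup>2 * ?M q"
        using opt q' expansion[OF ext[OF q']] by fastforce
    qed
  qed
qed

end
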